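(* Let $G$ and $H$ be two generalized groups. The direct product $$G\times H=\{(g,h) : g\in G \text{ and } h\in H\}$$ is a generalized group under the binary operation $\circ$ given by $$(g_1,h_1)\circ(g_2,h_2)=(g_1g_2,h_1h_2).$$
   Context: A generalized group is a non-empty set $G$ with a binary operation (written multiplicatively) such that: (i) $(xy)z=x(yz)$ for all $x,y,z\in G$; (ii) for each $x\in G$ there exists a unique element $e(x)\in G$ such that $xe(x)=e(x)x=x$; (iii) for each $x\in G$ there exists $x^{-1}\in G$ such that $xx^{-1}=x^{-1}x=e(x)$. *)

theory Defs
  imports Main
begin

text \<open>
  The element \<open>e(x)\<close>; it is a meaningful choice only when exactly one such element exists,
  which is what the axiom \<open>identity\<close> below requires.
\<close>

definition gg_identity :: "'a set \<Rightarrow> ('a \<Rightarrow> 'a \<Rightarrow> 'a) \<Rightarrow> 'a \<Rightarrow> 'a" where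
  "gg_identity G m x = (THE e. e \<in> G \<and> m x e = x \<and> m e x = x)"

text \<open>The operation is a total HOL function, but only its values on \<open>G\<close> are constrained.\<close>

locale generalized_group =
  fixes G :: "'a set" and m :: "'a \<Rightarrow> 'a \<Rightarrow> 'a" (infixl \<open>\<cdot>\<close> 70)
  assumes nonempty: "G \<noteq> {}"
    and closed: "\<lbrakk>x \<in> G; y \<in> G\<rbrakk> \<Longrightarrow> x \<cdot> y \<in> G"
    and assoc: "\<lbrakk>x \<in> G; y \<in> G; z \<in> G\<rbrakk> \<Longrightarrow> (x \<cdot> y) \<cdot> z = x \<cdot> (y \<cdot> z)"
    and identity: "x \<in> G \<Longrightarrow> \<exists>!e. e \<in> G \<and> x \<cdot> e = x \<and> e \<cdot> x = x"
    and inverse: "x \<in> G \<Longrightarrow> \<exists>y\<in>G. x \<cdot> y = gg_identity G m x \<and> y \<cdot> x = gg_identity G m x"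

end

theory Submission
  imports Defs
begin

text \<open>All the axioms hold componentwise. The only delicate point is the identity, since the
  inverse axiom refers to it through a definite description over the product. A pair is neutral for
  \<open>(g, h)\<close> exactly when its components are neutral for \<open>g\<close> and
  \<open>h\<close>, so uniqueness in both factors forces it to be \<open>(e(g), e(h))\<close>. Pairs
  of inverses are then inverses.\<close>

lemma gg_identity_eqI:
  assumes "generalized_group G m" "x \<in> G" "e \<in> G" "m x e = x" "m e x = x"
  shows "gg_identity G m x = e"
  unfolding gg_identity_def
  using generalized_group.identity[OF assms(1,2)] assms(3-5) by (intro the1_equality) auto

lemma gg_identity_in_and_neutral:
  assumes "generalized_group G m" "x \<in> G"
  shows "gg_identity G m x \<in> G \<and> m x (gg_identity G m x) = x \<and> m (gg_identity G m x) x = x"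
  unfolding gg_identity_def using generalized_group.identity[OF assms] by (rule theI')

theorem theorem3p7:
  fixes G :: "'a set" and mG :: "'a \<Rightarrow> 'a \<Rightarrow> 'a"
    and H :: "'b set" and mH :: "'b \<Rightarrow> 'b \<Rightarrow> 'b"
  assumes "generalized_group G mG" and "generalized_group H mH"
  shows "generalized_group (G \<times> H) (\<lambda>(g1, h1) (g2, h2). (mG g1 g2, mH h1 h2))"
    (is "generalized_group _ ?m")
proof -
  interpret G: generalized_group G mG by fact
  interpret H: generalized_group H mH by fact
  let ?e = "\<lambda>(g, h). (gg_identity G mG g, gg_identity H mH h)"
  \<comment> \<open>Left to right uses uniqueness in each factor (\<open>gg_identity_eqI\<close>),
    right to left neutrality (\<open>gg_identity_in_and_neutral\<close>). As an equivalence it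
    yields both the identity axiom and the value of \<open>gg_identity\<close> on the
    product.\<close>
  have neutral_iff: "e \<in> G \<times> H \<and> ?m x e = x \<and> ?m e x = x \<longleftrightarrow> e = ?e x"
    if "x \<in> G \<times> H" for x e
    using that gg_identity_in_and_neutral[OF assms(1)] gg_identity_in_and_neutral[OF assms(2)]
      gg_identity_eqI[OF assms(1)] gg_identity_eqI[OF assms(2)]
    by (cases x; cases e) auto
  \<comment> \<open>Rewriting turns the description into \<open>THE e. e = ?e x\<close>.\<close>
  have identity_eq: "gg_identity (G \<times> H) ?m x = ?e x" if "x \<in> G \<times> H" for x
    unfolding gg_identity_def neutral_iff[OF that] by (rule the_eq_trivial)
  show ?thesis
  proof
    show "G \<times> H \<noteq> {}" using G.nonempty H.nonempty by auto
  next
    fix x y assume "x \<in> G \<times> H" "y \<in> G \<times> H"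
    then show "?m x y \<in> G \<times> H" using G.closed H.closed by auto
  next
    fix x y z assume "x \<in> G \<times> H" "y \<in> G \<times> H" "z \<in> G \<times> H"
    then show "?m (?m x y) z = ?m x (?m y z)" using G.assoc H.assoc by auto
  next
    fix x assume "x \<in> G \<times> H"
    then show "\<exists>!e. e \<in> G \<times> H \<and> ?m x e = x \<and> ?m e x = x"
      unfolding neutral_iff[OF \<open>x \<in> G \<times> H\<close>] by simp
  next
    fix x assume x: "x \<in> G \<times> H"
    then obtain g h where [simp]: "x = (g, h)" and "g \<in> G" "h \<in> H" by auto
    then obtain g' h' where "g' \<in> G" "mG g g' = gg_identity G mG g" "mG g' g = gg_identity G mG g"
      and "h' \<in> H" "mH h h' = gg_identity H mH h" "mH h' h = gg_identity H mH h"
      using G.inverse H.inverse by metis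
    \<comment> \<open>With the product identity now known to be the pair of identities, the pair of
      factor inverses is a witness.\<close>
    then show "\<exists>y\<in>G \<times> H. ?m x y = gg_identity (G \<times> H) ?m x \<and> ?m y x = gg_identity (G \<times> H) ?m x"
      unfolding identity_eq[OF x] by (intro bexI[of _ "(g', h')"]) auto
  qed
qed

end
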